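(* Let $h:\Delta\to\mathbb{C}$ be a univalent (holomorphic and injective) function on the open unit disk $\Delta$. For $\alpha\in(0,1)$ and $x_0\in\Delta$ define $$\Omega_\alpha:=\left\{x\in\Delta:\ \alpha\,|h'(x_0)|(1-|x_0|^2)<|h'(x)|(1-|x|^2)\right\}.$$ Then the image $h(\Omega_\alpha)$ covers (contains) the open disk of radius $\dfrac{1-\alpha}{4}\,|h'(x_0)|(1-|x_0|^2)$ centered at $h(x_0)$.
   Context: $\Delta=\{z\in\mathbb{C}:|z|<1\}$. The function $h$ is not assumed to be normalized. *)

theory Defs
  imports "HOL-Complex_Analysis.Complex_Analysis"
begin

definition Omega :: "(complex \<Rightarrow> complex) \<Rightarrow> complex \<Rightarrow> real \<Rightarrow> complex set" where
  "Omega h x0 \<alpha> =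
     {x \<in> ball 0 1. \<alpha> * norm (deriv h x0) * (1 - (norm x0)\<^sup>2) < norm (deriv h x) * (1 - (norm x)\<^sup>2)}"

end

theory Submission
  imports Defs "HOL-Computational_Algebra.Fundamental_Theorem_Algebra"
begin

text \<open>
  The quantity \<open>|h'(x)| (1 - |x|\<^sup>2)\<close> is the conformal radius of the image domain at \<open>h x\<close>. By
  Bieberbach's inequality \<open>|a\<^sub>2| \<le> 2\<close>, applied after a disk automorphism, it is a 4-Lipschitz function
  of \<open>h x\<close> along segments in the image, and by Koebe's 1/4-theorem the disk in question lies in the
  image.

  Koebe's theorem is obtained from a Chebyshev-constant argument instead of the area theorem. If
  \<open>f z = z + \<dots>\<close> is univalent, let \<open>K\<close> consist of \<open>0\<close> and the reciprocals of the values omitted by \<open>f\<close>.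
  The Taylor coefficients of \<open>1 / (1 - \<kappa> f)\<close> are monic polynomials \<open>Q\<^sub>n\<close> in \<open>\<kappa>\<close>, and by Cauchy's
  inequality \<open>|Q\<^sub>n| \<le> C r\<^sup>-\<^sup>n\<close> on \<open>K\<close> for every \<open>r < 1\<close>. Since \<open>f\<close> has simply connected image, \<open>K\<close> meets
  every circle about \<open>0\<close> of radius up to \<open>1/|w|\<close>, for an omitted value \<open>w\<close>. As \<open>z \<mapsto> |z|\<close> does not increase distances,
  \<open>|Q\<^sub>n|\<close> is somewhere on \<open>K\<close> at least as large as a monic real polynomial can be forced to be on
  \<open>[0, 1/|w|]\<close>, namely \<open>(1/(4|w|))\<^sup>n\<close>; hence \<open>1/(4|w|) \<le> 1\<close>.

  Bieberbach's inequality follows by applying Koebe's theorem to \<open>f\<close> composed with the conformal map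
  of the disk onto the disk with the slit \<open>[t, 1)\<close> removed, and letting \<open>t \<rightarrow> 0\<close>.
\<close>

section \<open>Koebe's quarter theorem from monic polynomials\<close>

text \<open>On the unit circle \<open>1 + u = u * cnj (1 + u)\<close>. This parametrises a real
  interval by the circle, and later shows that the Koebe function sends the circle without -1 into
  the ray from 1/4.\<close>

lemma one_plus_unimodular:
  fixes u :: complex
  assumes "norm u = 1"
  shows "(1 + u)\<^sup>2 = u * of_real ((norm (1 + u))\<^sup>2)" and "(norm (1 + u))\<^sup>2 \<le> 4"
proof -
  have uu: "u * cnj u = 1"
    using assms by (simp add: complex_norm_square [symmetric])
  have "u * of_real ((norm (1 + u))\<^sup>2) = (1 + u) * (u + u * cnj u)"
    unfolding complex_norm_square by (simp add: algebra_simps)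
  also have "\<dots> = (1 + u)\<^sup>2"
    unfolding uu by (simp add: power2_eq_square add.commute)
  finally show "(1 + u)\<^sup>2 = u * of_real ((norm (1 + u))\<^sup>2)" ..
  have "norm (1 + u) \<le> 2"
    using norm_triangle_ineq[of 1 u] assms by simp
  thus "(norm (1 + u))\<^sup>2 \<le> 4"
    using power_mono[of "norm (1 + u)" 2 2] by simp
qed

text \<open>Substitute \<open>t = s (2 + u + 1/u)\<close> with \<open>|u| = 1\<close>: the product times \<open>u\<^sup>n\<close> becomes a polynomial in \<open>u\<close>
  with value \<open>s\<^sup>n\<close> at \<open>0\<close>, and the maximum principle applies.\<close>
lemma exists_large_prod_abs_diff:
  fixes a :: "nat \<Rightarrow> real" and s :: real
  assumes "0 \<le> s"
  obtains t where "0 \<le> t" "t \<le> 4 * s" "s ^ n \<le> (\<Prod>i<n. \<bar>t - a i\<bar>)"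
proof -
  define P where "P u = (\<Prod>i<n. of_real s * (1 + u)\<^sup>2 - of_real (a i) * u)" for u :: complex
  have cont: "continuous_on A (\<lambda>u. norm (P u))" for A
    unfolding P_def by (intro continuous_intros)
  obtain u where u: "norm u = 1" and max: "\<And>y. norm y = 1 \<Longrightarrow> norm (P y) \<le> norm (P u)"
    using continuous_attains_sup[OF _ _ cont, of "sphere (0::complex) 1"]
    by (auto simp: dist_norm)
  have "P holomorphic_on ball 0 1" "continuous_on (cball 0 1) P"
    unfolding P_def by (intro holomorphic_intros continuous_intros)+
  \<comment> \<open>Order 0 turns Cauchy's inequality into the maximum principle at the
    centre.\<close>
  hence "norm ((deriv ^^ 0) P 0) \<le> fact 0 * norm (P u) / 1 ^ 0"
    by (rule Cauchy_inequality) (auto intro: max)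
  hence "s ^ n \<le> norm (P u)"
    using assms by (simp add: P_def norm_power prod_constant)
  define t where "t = s * (norm (1 + u))\<^sup>2"
  have t4: "t \<le> 4 * s"
    using mult_left_mono[OF one_plus_unimodular(2)[OF u] assms] by (simp add: t_def mult.commute)
  have "(1 + u)\<^sup>2 = u * of_real ((norm (1 + u))\<^sup>2)"
    by (rule one_plus_unimodular[OF u])
  hence "of_real s * (1 + u)\<^sup>2 - of_real (a i) * u = u * of_real (t - a i)" for i
    by (simp add: t_def algebra_simps)
  hence "norm (P u) = (\<Prod>i<n. \<bar>t - a i\<bar>)"
    by (simp only: P_def prod_norm[symmetric] norm_mult u norm_of_real) simp
  with \<open>s ^ n \<le> norm (P u)\<close> t4 show ?thesis
    using that[of t] assms by (simp add: t_def)
qed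

text \<open>The recursion is \<open>q = 1 + \<kappa> f q\<close> for \<open>q = 1 / (1 - \<kappa> f)\<close>, with \<open>c\<close> the Taylor coefficients of \<open>f\<close>.\<close>
fun resolvent_poly :: "(nat \<Rightarrow> complex) \<Rightarrow> nat \<Rightarrow> complex poly" where
  "resolvent_poly c n = (if n = 0 then 1 else [:0, 1:] * (\<Sum>i<n. smult (c (n - i)) (resolvent_poly c i)))"

declare resolvent_poly.simps [simp del]

lemma degree_resolvent_poly_le: "degree (resolvent_poly c n) \<le> n"
proof (induction n rule: less_induct)
  case (less n)
  show ?case
  proof (cases "n = 0")
    case False
    have "degree (\<Sum>i<n. smult (c (n - i)) (resolvent_poly c i)) \<le> n - 1"
    proof (rule degree_sum_le)
      fix i assume "i \<in> {..<n}"
      with less.IH[of i] degree_smult_le[of "c (n - i)" "resolvent_poly c i"]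
      show "degree (smult (c (n - i)) (resolvent_poly c i)) \<le> n - 1" by simp
    qed simp
    with False show ?thesis
      by (subst resolvent_poly.simps) (auto intro: order_trans[OF degree_pCons_le])
  qed (simp add: resolvent_poly.simps)
qed

text \<open>The factor \<open>[:0, 1:]\<close> shifts degrees by one, so for \<open>Suc n\<close>
  only the summand \<open>i = n\<close> reaches the top degree, and its weight is
  \<open>c 1 = 1\<close>. The Chebyshev bound requires monic polynomials.\<close>

lemma coeff_resolvent_poly:
  assumes "c 1 = 1"
  shows "coeff (resolvent_poly c n) n = 1"
proof (induction n)
  case (Suc n)
  have "coeff (resolvent_poly c (Suc n)) (Suc n) = (\<Sum>i<Suc n. c (Suc n - i) * coeff (resolvent_poly c i) n)"
    by (subst resolvent_poly.simps) (simp add: coeff_sum del: sum.lessThan_Suc)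
  also have "\<dots> = (\<Sum>i<n. c (Suc n - i) * coeff (resolvent_poly c i) n) + 1"
    using Suc assms by simp
  also have "(\<Sum>i<n. c (Suc n - i) * coeff (resolvent_poly c i) n) = 0"
    using degree_resolvent_poly_le[of c] by (intro sum.neutral) (auto intro!: coeff_eq_0 le_less_trans[OF degree_resolvent_poly_le])
  finally show ?case by simp
qed (simp add: resolvent_poly.simps)

lemma degree_resolvent_poly: "c 1 = 1 \<Longrightarrow> degree (resolvent_poly c n) = n"
  using coeff_resolvent_poly[of c n] degree_resolvent_poly_le[of c n] le_degree[of "resolvent_poly c n" n]
  by (simp add: order_antisym)

text \<open>By the reverse triangle inequality, replacing \<open>z\<close> and all roots by their
  moduli does not increase distances. Only the moduli of the points of a set then matter for a lower
  bound.\<close>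

lemma norm_poly_ge_prod:
  fixes p :: "complex poly"
  assumes "lead_coeff p = 1"
  obtains a :: "nat \<Rightarrow> real" where "\<And>z. (\<Prod>i<degree p. \<bar>norm z - a i\<bar>) \<le> norm (poly p z)"
proof -
  obtain root where p: "smult (lead_coeff p) (\<Prod>i<degree p. [:-root i, 1:]) = p"
    by (rule complex_poly_decompose')
  show ?thesis
  proof
    fix z
    have "poly p z = (\<Prod>i<degree p. z - root i)"
      using assms by (subst p[symmetric]) (simp add: poly_prod)
    hence "norm (poly p z) = (\<Prod>i<degree p. norm (z - root i))"
      by (simp add: prod_norm)
    thus "(\<Prod>i<degree p. \<bar>norm z - norm (root i)\<bar>) \<le> norm (poly p z)"
      by (simp add: prod_mono norm_triangle_ineq3)
  qed
qed

text \<open>Compare power series at 0 in \<open>q = 1 + \<kappa> * f * q\<close>. Since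
  \<open>f 0 = 0\<close>, the top summand of the Cauchy product vanishes, which leaves the recursion
  of \<open>resolvent_poly\<close>.\<close>

lemma higher_deriv_inverse_eq_resolvent_poly:
  assumes f: "f holomorphic_on ball 0 1" and "f 0 = 0"
    and nz: "\<And>z. z \<in> ball 0 1 \<Longrightarrow> \<kappa> * f z \<noteq> 1"
  shows "(deriv ^^ n) (\<lambda>z. 1 / (1 - \<kappa> * f z)) 0 / fact n
    = poly (resolvent_poly (\<lambda>k. (deriv ^^ k) f 0 / fact k) n) \<kappa>"
proof -
  define c where "c = (\<lambda>k. (deriv ^^ k) f 0 / fact k)"
  define F where "F = fps_expansion f 0"
  define q where "q = (\<lambda>z. 1 / (1 - \<kappa> * f z))"
  define Q where "Q = fps_expansion q 0"
  have nz': "1 - \<kappa> * f z \<noteq> 0" if "z \<in> ball 0 1" for z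
    using nz[OF that] by (metis eq_iff_diff_eq_0)
  have hq: "q holomorphic_on ball 0 1"
    unfolding q_def using nz' by (intro holomorphic_intros f) auto
  have c_nth: "fps_nth F k = c k" for k
    by (simp add: F_def c_def fps_expansion_def)
  have eF: "f has_fps_expansion F" and eQ: "q has_fps_expansion Q"
    unfolding F_def Q_def using f hq by (auto intro!: has_fps_expansion_fps_expansion[of "ball 0 1"])
  have "(\<lambda>z. q z - 1 - \<kappa> * (f z * q z)) has_fps_expansion (Q - 1 - fps_const \<kappa> * (F * Q))"
    using eF eQ by (intro fps_expansion_intros)
  moreover have "eventually (\<lambda>z. q z - 1 - \<kappa> * (f z * q z) = 0) (nhds 0)"
  proof (rule eventually_mono)
    show "eventually (\<lambda>z. z \<in> ball (0::complex) 1) (nhds 0)"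
      by (intro eventually_nhds_in_open) auto
  next
    fix z :: complex assume "z \<in> ball 0 1"
    hence "(1 - \<kappa> * f z) * q z = 1" unfolding q_def using nz' by simp
    thus "q z - 1 - \<kappa> * (f z * q z) = 0" by (simp add: algebra_simps)
  qed
  ultimately have "(\<lambda>z. 0) has_fps_expansion (Q - 1 - fps_const \<kappa> * (F * Q))"
    by (subst (asm) has_fps_expansion_cong[OF _ refl])
  hence "Q - 1 - fps_const \<kappa> * (F * Q) = 0"
    by (rule fps_expansion_unique_complex[OF _ has_fps_expansion_0])
  hence Q: "Q = 1 + fps_const \<kappa> * (F * Q)" by (simp add: algebra_simps)
  have F0: "c 0 = 0" using \<open>f 0 = 0\<close> by (simp add: c_def)
  have "fps_nth Q n = poly (resolvent_poly c n) \<kappa>"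
  proof (induction n rule: less_induct)
    case (less n)
    show ?case
    proof (cases "n = 0")
      case True
      thus ?thesis by (subst Q) (simp add: c_nth F0 resolvent_poly.simps)
    next
      case False
      have "fps_nth Q n = \<kappa> * fps_nth (Q * F) n"
        by (subst Q) (use False in \<open>simp add: mult.commute\<close>)
      also have "fps_nth (Q * F) n = (\<Sum>i\<le>n. fps_nth Q i * c (n - i))"
        by (simp add: fps_mult_nth c_nth atLeast0AtMost)
      also have "\<dots> = (\<Sum>i<n. fps_nth Q i * c (n - i))"
        by (simp add: F0 lessThan_Suc_atMost[symmetric])
      also have "\<dots> = (\<Sum>i<n. poly (resolvent_poly c i) \<kappa> * c (n - i))"
        using less by simp
      finally show ?thesis
        using False by (subst resolvent_poly.simps) (simp add: poly_sum mult.commute)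
    qed
  qed
  thus ?thesis by (simp add: Q_def q_def c_def fps_expansion_def)
qed

lemma simply_connected_inj_holomorphic_image:
  fixes S :: "complex set"
  assumes "f holomorphic_on S" "inj_on f S" "open S" "simply_connected S"
  shows "simply_connected (f ` S)"
proof -
  have "S homeomorphic f ` S"
    using assms by (intro invariance_of_domain_homeomorphic holomorphic_on_imp_continuous_on) auto
  thus ?thesis using homeomorphic_simply_connected_eq assms(4) by blast
qed

text \<open>If the circle lay in \<open>S\<close>, then \<open>norm w < R\<close> and its winding
  number about \<open>w\<close> would be 1, while simple connectedness forces 0. For the image of
  \<open>f\<close> this gives omitted values of every modulus from \<open>norm w\<close> on.\<close>

lemma sphere_not_subset_simply_connected:
  fixes w :: complex
  assumes "simply_connected S" "w \<notin> S" "norm w \<le> R"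
  shows "\<exists>v. norm v = R \<and> v \<notin> S"
proof (rule ccontr)
  assume "\<not> ?thesis"
  hence S: "v \<in> S" if "norm v = R" for v using that by blast
  hence "norm w \<noteq> R" using \<open>w \<notin> S\<close> by blast
  with assms have "norm w < R" by simp
  hence "0 < R" using norm_ge_zero[of w] by linarith
  have "winding_number (circlepath 0 R) w = 0"
    by (rule simply_connected_imp_winding_number_zero[OF assms(1)])
       (use S \<open>0 < R\<close> assms in \<open>auto simp: dist_norm\<close>)
  moreover have "winding_number (circlepath 0 R) w = 1"
    by (rule winding_number_circlepath) (use \<open>norm w < R\<close> in simp)
  ultimately show False by simp
qed

lemma koebe_quarter_normalized:
  assumes f: "f holomorphic_on ball 0 1" and inj: "inj_on f (ball 0 1)"
    and f0: "f 0 = 0" and f1: "deriv f 0 = 1" and w: "w \<notin> f ` ball 0 1"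
  shows "1/4 \<le> norm w"
proof (rule ccontr)
  assume "\<not> ?thesis"
  hence w4: "norm w < 1/4" by simp
  have "w \<noteq> 0" using w f0 by force
  \<comment> \<open>Chosen so that \<open>4 * s = 1 / norm w\<close> is the length of the interval
    of radii met by \<open>K\<close>; the Chebyshev lower bound is then \<open>s ^ n\<close> with
    \<open>s > 1\<close>.\<close>
  define s where "s = 1 / (4 * norm w)"
  have s1: "1 < s" using w4 \<open>w \<noteq> 0\<close> by (simp add: s_def field_simps)
  \<comment> \<open>The product form of the condition admits \<open>\<kappa> = 0\<close> without a
    division; the cutoff at \<open>4 * s\<close> makes \<open>K\<close> bounded.\<close>
  define K where "K = {\<kappa>. norm \<kappa> \<le> 4 * s \<and> (\<forall>z\<in>ball 0 1. \<kappa> * f z \<noteq> 1)}"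
  have radii: "\<exists>\<kappa>\<in>K. norm \<kappa> = t" if t: "0 \<le> t" "t \<le> 4 * s" for t
  proof (cases "t = 0")
    case True
    thus ?thesis using s1 by (intro bexI[of _ 0]) (auto simp: K_def)
  next
    case False
    have "simply_connected (f ` ball 0 1)"
      by (intro simply_connected_inj_holomorphic_image f inj) (auto simp: convex_imp_simply_connected)
    moreover have "norm w \<le> 1 / t"
      using False t \<open>w \<noteq> 0\<close> by (simp add: s_def field_simps)
    ultimately obtain v where v: "norm v = 1 / t" "v \<notin> f ` ball 0 1"
      using sphere_not_subset_simply_connected w by blast
    have "v \<noteq> 0" using v False by auto
    hence "1 / v \<in> K"
      using v t by (auto simp: K_def norm_divide field_simps)
    thus ?thesis using v by (intro bexI[of _ "1 / v"]) (auto simp: norm_divide)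
  qed
  have "compact K"
  proof -
    have "open (f ` ball 0 1)"
      using f inj by (intro open_mapping_thm3) auto
    \<comment> \<open>The excluded \<open>\<kappa>\<close> form the inverted image of
      \<open>f\<close>. The point 0 must be removed by hand: \<open>1 / 0 = 0\<close> lies in the
      image, but 0 belongs to \<open>K\<close>.\<close>
    hence "open ((-{0}) \<inter> (\<lambda>\<kappa>. 1 / \<kappa>) -` (f ` ball 0 1))"
      by (intro continuous_open_preimage continuous_intros) auto
    moreover have "K = cball 0 (4 * s) - ((-{0}) \<inter> (\<lambda>\<kappa>. 1 / \<kappa>) -` (f ` ball 0 1))"
    proof -
      have "\<kappa> * f z = 1 \<longleftrightarrow> \<kappa> \<noteq> 0 \<and> 1 / \<kappa> = f z" for \<kappa> z
        by (cases "\<kappa> = 0") (auto simp: divide_eq_eq mult.commute)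
      thus ?thesis unfolding K_def set_eq_iff by (simp add: image_iff)
    qed
    ultimately show ?thesis by (simp add: compact_diff)
  qed
  \<comment> \<open>The midpoint of \<open>1 / s\<close> and 1: a radius inside the disk that still
    satisfies \<open>s * r > 1\<close>.\<close>
  define r where "r = (1 / s + 1) / 2"
  have r: "0 < r" "r < 1" "1 < s * r"
    using s1 by (auto simp: r_def field_simps)
  have cr: "cball 0 r \<subseteq> ball (0::complex) 1" using r by auto
  have cont: "continuous_on (K \<times> cball 0 r) (\<lambda>p. norm (1 - fst p * f (snd p)))"
  proof -
    have "continuous_on (K \<times> cball 0 r) (\<lambda>p. f (snd p))"
      using cr by (intro continuous_on_compose2[OF holomorphic_on_imp_continuous_on[OF f]] continuous_intros) auto
    thus ?thesis by (intro continuous_intros)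
  qed
  have "compact (K \<times> cball (0::complex) r)" "K \<times> cball (0::complex) r \<noteq> {}"
    using \<open>compact K\<close> radii[of 0] s1 r by (auto intro: compact_Times)
  from continuous_attains_inf[OF this cont]
  obtain p where p: "p \<in> K \<times> cball 0 r"
    and pmin: "\<And>y. y \<in> K \<times> cball 0 r \<Longrightarrow> norm (1 - fst p * f (snd p)) \<le> norm (1 - fst y * f (snd y))"
    by blast
  \<comment> \<open>Compactness gives one bound \<open>1 / m\<close> for all the functions
    \<open>1 / (1 - \<kappa> * f z)\<close> on the disk of radius \<open>r\<close>, independent of
    \<open>\<kappa>\<close> and of the coefficient index.\<close>
  define m where "m = norm (1 - fst p * f (snd p))"
  have "0 < m" using p cr by (force simp: m_def K_def)
  define c where "c = (\<lambda>k. (deriv ^^ k) f 0 / fact k)"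
  have c1: "c 1 = 1" using f1 by (simp add: c_def)
  have upper: "norm (poly (resolvent_poly c n) \<kappa>) \<le> (1 / m) / r ^ n" if \<kappa>: "\<kappa> \<in> K" for \<kappa> n
  proof -
    have nz: "\<kappa> * f z \<noteq> 1" if "z \<in> ball 0 1" for z using \<kappa> that by (auto simp: K_def)
    define q where "q = (\<lambda>z. 1 / (1 - \<kappa> * f z))"
    have hq: "q holomorphic_on ball 0 1"
      unfolding q_def using nz by (intro holomorphic_intros f) (metis eq_iff_diff_eq_0)
    have "norm ((deriv ^^ n) q 0) \<le> fact n * (1 / m) / r ^ n"
    proof (rule Cauchy_inequality)
      show "q holomorphic_on ball 0 r" "continuous_on (cball 0 r) q"
        using cr r by (auto intro: holomorphic_on_subset[OF hq] holomorphic_on_imp_continuous_on)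
      show "norm (q x) \<le> 1 / m" if "norm (0 - x) = r" for x
      proof -
        have "m \<le> norm (1 - \<kappa> * f x)"
          using pmin[of "(\<kappa>, x)"] \<kappa> that by (simp add: m_def)
        thus ?thesis
          using frac_le[of 1 1 m] \<open>0 < m\<close> by (simp add: q_def norm_divide)
      qed
    qed (use r in auto)
    hence "norm ((deriv ^^ n) q 0 / fact n) \<le> (1 / m) / r ^ n"
      by (simp add: norm_divide field_simps)
    thus ?thesis
      using higher_deriv_inverse_eq_resolvent_poly[OF f f0 nz, of n] by (simp add: q_def c_def)
  qed
  \<comment> \<open>The radius \<open>t\<close> and the point \<open>\<kappa>\<close> on it vary
    with \<open>n\<close>, but the bound \<open>1 / m\<close> does not; hence the powers of
    \<open>s * r > 1\<close> would stay bounded.\<close>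
  have bounded: "(s * r) ^ n \<le> 1 / m" for n
  proof -
    obtain a :: "nat \<Rightarrow> real"
      where a: "\<And>z. (\<Prod>i<n. \<bar>norm z - a i\<bar>) \<le> norm (poly (resolvent_poly c n) z)"
      using norm_poly_ge_prod[of "resolvent_poly c n"] coeff_resolvent_poly[of c n, OF c1] degree_resolvent_poly[of c n, OF c1] by metis
    obtain t where t: "0 \<le> t" "t \<le> 4 * s" "s ^ n \<le> (\<Prod>i<n. \<bar>t - a i\<bar>)"
      using exists_large_prod_abs_diff[of s n a] s1 by auto
    obtain \<kappa> where "\<kappa> \<in> K" "norm \<kappa> = t" using radii t by blast
    with t a[of \<kappa>] upper[of \<kappa> n] have "s ^ n \<le> (1 / m) / r ^ n" by simp
    thus ?thesis using r \<open>0 < m\<close> by (simp add: field_simps)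
  qed
  obtain n where "1 / m < (s * r) ^ n"
    using real_arch_pow[OF r(3)] by blast
  with bounded[of n] show False by simp
qed

lemma koebe_quarter:
  assumes f: "f holomorphic_on ball 0 1" and inj: "inj_on f (ball 0 1)"
    and w: "w \<notin> f ` ball 0 1"
  shows "norm (deriv f 0) \<le> 4 * norm (w - f 0)"
proof (cases "deriv f 0 = 0")
  case False
  define F where "F = (\<lambda>z. (f z - f 0) / deriv f 0)"
  have "1/4 \<le> norm ((w - f 0) / deriv f 0)"
  proof (rule koebe_quarter_normalized[of F])
    show "F holomorphic_on ball 0 1"
      unfolding F_def using False by (intro holomorphic_intros f) auto
    show "inj_on F (ball 0 1)"
      using inj False by (auto simp: F_def inj_on_def)
    have "(f has_field_derivative deriv f 0) (at 0)"
      using f by (intro holomorphic_derivI[of f "ball 0 1"]) auto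
    hence "(F has_field_derivative 1) (at 0)"
      unfolding F_def using False by (auto intro!: derivative_eq_intros)
    thus "deriv F 0 = 1" by (rule DERIV_imp_deriv)
    show "(w - f 0) / deriv f 0 \<notin> F ` ball 0 1"
      using w False by (auto simp: F_def)
  qed (simp add: F_def)
  thus ?thesis using False by (simp add: norm_divide field_simps)
qed simp


section \<open>The Koebe function, slit maps and growth\<close>

text \<open>For these \<open>y\<close>, all solutions lie on the unit circle: the imaginary part of
  the quadratic equation forces modulus 1 for a non-real solution, and a real one can only be
  1.\<close>

lemma koebe_function_avoids_slit:
  fixes z :: complex
  assumes "norm z < 1" "1/4 \<le> y"
  shows "z / (1 + z)\<^sup>2 \<noteq> of_real y"
proof
  assume eq: "z / (1 + z)\<^sup>2 = of_real y"
  obtain a b where z: "z = Complex a b" by (cases z)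
  have ab: "a\<^sup>2 + b\<^sup>2 < 1"
    using assms(1) by (simp add: z cmod_def real_sqrt_lt_1_iff)
  have "1 + z \<noteq> 0" using assms by (metis add_eq_0_iff norm_minus_cancel norm_one less_irrefl)
  hence "z = of_real y * (1 + z)\<^sup>2" using eq by (simp add: field_simps)
  hence re: "a = y * ((1 + a)\<^sup>2 - b\<^sup>2)" and im: "b = y * (2 * (1 + a) * b)"
    by (simp_all add: z complex_eq_iff power2_eq_square algebra_simps)
  show False
  proof (cases "b = 0")
    case True
    have "(1 + a)\<^sup>2 \<le> 4 * y * (1 + a)\<^sup>2"
      using assms(2) by (intro mult_right_mono[of 1 "4 * y" "(1 + a)\<^sup>2", simplified]) auto
    hence "(1 - a)\<^sup>2 \<le> 0" using re True by (simp add: power2_eq_square algebra_simps)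
    hence "a = 1" by simp
    thus False using ab by simp
  next
    case False
    hence "y * (2 * (1 + a)) = 1" using im by simp
    hence "2 * (y * a) = 1 - 2 * y" by (simp add: algebra_simps)
    hence "y * (a\<^sup>2 + b\<^sup>2) = y"
      using re by (simp add: power2_eq_square algebra_simps) algebra
    thus False using ab assms(2) by simp
  qed
qed

text \<open>The two roots of the quadratic equation for \<open>z\<close> are reciprocal, so one lies
  in the disk unless both lie on the circle, and in that case \<open>w\<close> is on the
  slit.\<close>

lemma koebe_function_surj:
  fixes w :: complex
  assumes w: "\<And>y. 1/4 \<le> y \<Longrightarrow> w \<noteq> of_real y"
  obtains z where "norm z < 1" "z / (1 + z)\<^sup>2 = w"
proof (cases "w = 0")
  case True
  thus ?thesis using that[of 0] by simp
next
  case False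
  define z where "z = (1 - 2 * w + csqrt (1 - 4 * w)) / (2 * w)"
  have root: "w * (1 + z)\<^sup>2 = z"
  proof -
    have "(2 * w * z - (1 - 2 * w))\<^sup>2 = 1 - 4 * w"
      using False by (simp add: z_def)
    hence "4 * w * (w * (1 + z)\<^sup>2 - z) = 0"
      by (simp add: power2_eq_square algebra_simps)
    thus ?thesis using False by simp
  qed
  have "z \<noteq> 0" using root False by auto
  have "1 + z \<noteq> 0" using root \<open>z \<noteq> 0\<close> by auto
  have eq: "z / (1 + z)\<^sup>2 = w" using root \<open>1 + z \<noteq> 0\<close> by (simp add: field_simps)
  have "norm z \<noteq> 1"
  proof
    assume "norm z = 1"
    hence "(1 + z)\<^sup>2 = z * of_real ((norm (1 + z))\<^sup>2)"
      by (rule one_plus_unimodular)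
    hence "w = of_real (1 / (norm (1 + z))\<^sup>2)"
      using eq \<open>z \<noteq> 0\<close> by (simp add: field_simps)
    moreover have "1/4 \<le> 1 / (norm (1 + z))\<^sup>2"
      using \<open>1 + z \<noteq> 0\<close> one_plus_unimodular(2)[OF \<open>norm z = 1\<close>]
      by (intro divide_left_mono) auto
    ultimately show False using w by blast
  qed
  show ?thesis
  proof (cases "norm z < 1")
    case True
    thus ?thesis using that eq by blast
  next
    case False
    with \<open>norm z \<noteq> 1\<close> have "1 < norm z" by simp
    hence "norm (1 / z) < 1" using \<open>z \<noteq> 0\<close> by (simp add: norm_divide divide_less_eq)
    moreover have "(1 / z) / (1 + 1 / z)\<^sup>2 = w"
      using eq \<open>z \<noteq> 0\<close> \<open>1 + z \<noteq> 0\<close> by (simp add: field_simps power2_eq_square)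
    ultimately show ?thesis using that by blast
  qed
qed

text \<open>With the Koebe function \<open>k z = z / (1 + z)\<^sup>2\<close>, the map is \<open>\<phi> = k\<^sup>-\<^sup>1 \<circ> (4 k(t) k)\<close>.\<close>
lemma pick_function:
  fixes t :: real
  assumes t: "0 < t" "t < 1"
  obtains \<phi> :: "complex \<Rightarrow> complex" where
    "\<phi> holomorphic_on ball 0 1" "inj_on \<phi> (ball 0 1)" "\<phi> ` ball 0 1 \<subseteq> ball 0 1"
    "\<phi> 0 = 0" "of_real t \<notin> \<phi> ` ball 0 1"
    "(\<phi> has_field_derivative of_real (4 * t / (1 + t)\<^sup>2)) (at 0)"
proof -
  define k where "k = (\<lambda>z::complex. z / (1 + z)\<^sup>2)"
  \<comment> \<open>This is \<open>4 * k t\<close>: scaling by \<open>c\<close> moves the tip 1/4 of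
    the slit to \<open>k t\<close>, and \<open>c \<le> 1\<close> makes it map the slit plane into
    itself.\<close>
  define c where "c = 4 * t / (1 + t)\<^sup>2"
  have c: "0 < c" "c \<le> 1"
    using t sum_squares_ge_zero[of "1 - t" 0] by (auto simp: c_def field_simps power2_eq_square)
  have nz: "1 + z \<noteq> 0" if "z \<in> ball 0 1" for z :: complex
    using that by (metis add_eq_0_iff mem_ball_0 norm_minus_cancel norm_one less_irrefl)
  have hk: "k holomorphic_on ball 0 1"
    unfolding k_def by (intro holomorphic_intros) (use nz in auto)
  have ik: "inj_on k (ball 0 1)"
  proof (rule inj_onI)
    fix x y :: complex assume xy: "x \<in> ball 0 1" "y \<in> ball 0 1" "k x = k y"
    have "norm (x * y) < 1" using xy norm_mult_less[of x 1 y 1] by simp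
    hence "1 - x * y \<noteq> 0" by (metis eq_iff_diff_eq_0 norm_one less_irrefl)
    have "x * (1 + y)\<^sup>2 = y * (1 + x)\<^sup>2"
      using xy nz[of x] nz[of y] by (simp add: k_def frac_eq_eq)
    hence "(x - y) * (1 - x * y) = 0" by (simp add: power2_eq_square algebra_simps)
    thus "x = y" using \<open>1 - x * y \<noteq> 0\<close> by simp
  qed
  obtain g where hg: "g holomorphic_on k ` ball 0 1"
    and dg: "\<And>z. z \<in> ball 0 1 \<Longrightarrow> deriv k z * deriv g (k z) = 1"
    and gk: "\<And>z. z \<in> ball 0 1 \<Longrightarrow> g (k z) = z"
    using holomorphic_has_inverse[OF hk _ ik] by auto
  have ck: "of_real c * k z \<in> k ` ball 0 1" if "z \<in> ball 0 1" for z
  proof -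
    have "of_real c * k z \<noteq> of_real y" if y: "1/4 \<le> y" for y
    proof
      assume "of_real c * k z = of_real y"
      hence "k z = of_real (y / c)" using c by (simp add: field_simps)
      moreover have "y * c \<le> y * 1" using y c by (intro mult_left_mono) auto
      hence "1/4 \<le> y / c" using y c by (simp add: field_simps)
      ultimately show False
        using koebe_function_avoids_slit[of z "y / c"] \<open>z \<in> ball 0 1\<close> by (simp add: k_def)
    qed
    then obtain x where "norm x < 1" "x / (1 + x)\<^sup>2 = of_real c * k z"
      using koebe_function_surj by metis
    thus ?thesis by (auto simp: k_def intro!: image_eqI[of _ _ x])
  qed
  define \<phi> where "\<phi> = (\<lambda>z. g (of_real c * k z))"
  have \<phi>: "\<phi> z \<in> ball 0 1" "k (\<phi> z) = of_real c * k z" if "z \<in> ball 0 1" for z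
    using ck[OF that] gk by (auto simp: \<phi>_def)
  show ?thesis
  proof
    show "\<phi> holomorphic_on ball 0 1"
      unfolding \<phi>_def
      by (rule holomorphic_on_compose_gen[OF _ hg, unfolded o_def])
         (use ck in \<open>auto intro!: holomorphic_intros hk\<close>)
    show "inj_on \<phi> (ball 0 1)"
    proof (rule inj_onI)
      fix x y assume "x \<in> ball 0 1" "y \<in> ball 0 1" "\<phi> x = \<phi> y"
      with \<phi>(2)[of x] \<phi>(2)[of y] c have "k x = k y" by auto
      thus "x = y" using ik \<open>x \<in> ball 0 1\<close> \<open>y \<in> ball 0 1\<close> by (meson inj_onD)
    qed
    show "\<phi> ` ball 0 1 \<subseteq> ball 0 1" using \<phi> by blast
    have k0: "k 0 = 0" by (simp add: k_def)
    show "\<phi> 0 = 0" using gk[of 0] by (simp add: \<phi>_def k0)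
    show "of_real t \<notin> \<phi> ` ball 0 1"
    proof
      assume "of_real t \<in> \<phi> ` ball 0 1"
      then obtain z where z: "z \<in> ball 0 1" "\<phi> z = of_real t" by force
      have "1 + complex_of_real t \<noteq> 0" using nz[of "of_real t"] t by simp
      hence "of_real c * k z = of_real c * (1/4)"
        using \<phi>(2)[OF z(1)] by (simp add: z c_def k_def)
      hence "k z = of_real (1/4)" using c by simp
      thus False using koebe_function_avoids_slit[of z "1/4"] z by (simp add: k_def)
    qed
    have dk: "(k has_field_derivative 1) (at 0)"
      unfolding k_def by (auto intro!: derivative_eq_intros)
    hence "deriv g (k 0) = 1" using dg[of 0] by (simp add: DERIV_imp_deriv)
    moreover have "open (k ` ball 0 1)"
      using hk ik by (intro open_mapping_thm3) auto
    hence "(g has_field_derivative deriv g (k 0)) (at (k 0))"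
      by (intro holomorphic_derivI[OF hg]) auto
    ultimately have "(g has_field_derivative 1) (at (of_real c * k 0))" by (simp add: k0)
    from DERIV_chain2[OF this DERIV_cmult[OF dk, of "of_real c"]]
    show "(\<phi> has_field_derivative of_real (4 * t / (1 + t)\<^sup>2)) (at 0)"
      by (simp add: \<phi>_def c_def)
  qed
qed

text \<open>Since \<phi> omits \<open>t\<close>, the univalent function
  \<open>f (\<phi> z * u)\<close> omits \<open>f (t * u)\<close>. Koebe's theorem for it gives the
  bound, with the factor contributed by the derivative of \<phi> at 0.\<close>

lemma growth_lower_bound:
  assumes f: "f holomorphic_on ball 0 1" and inj: "inj_on f (ball 0 1)"
    and t: "0 < t" "t < 1" and u: "norm u = 1"
  shows "norm (deriv f 0) * t \<le> norm (f (of_real t * u) - f 0) * (1 + t)\<^sup>2"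
proof -
  obtain \<phi> where \<phi>: "\<phi> holomorphic_on ball 0 1" "inj_on \<phi> (ball 0 1)" "\<phi> ` ball 0 1 \<subseteq> ball 0 1"
    "\<phi> 0 = 0" "of_real t \<notin> \<phi> ` ball 0 1"
    and d\<phi>: "(\<phi> has_field_derivative of_real (4 * t / (1 + t)\<^sup>2)) (at 0)"
    using pick_function[OF t] by metis
  define F where "F = (\<lambda>z. f (\<phi> z * u))"
  have im: "\<phi> z * u \<in> ball 0 1" if "z \<in> ball 0 1" for z
    using image_subset_iff[THEN iffD1, OF \<phi>(3)] that u by (auto simp: norm_mult)
  have "u \<noteq> 0" using u by auto
  have "norm (deriv F 0) \<le> 4 * norm (f (of_real t * u) - F 0)"
  proof (rule koebe_quarter)
    show "F holomorphic_on ball 0 1"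
      unfolding F_def
      by (rule holomorphic_on_compose_gen[OF _ f, unfolded o_def])
         (use im in \<open>auto intro!: holomorphic_intros \<phi>(1)\<close>)
    show "inj_on F (ball 0 1)"
    proof (rule inj_onI)
      fix x y assume "x \<in> ball 0 1" "y \<in> ball 0 1" "F x = F y"
      with im have "\<phi> x * u = \<phi> y * u" using inj by (auto simp: F_def dest: inj_onD)
      thus "x = y" using \<open>u \<noteq> 0\<close> \<phi>(2) \<open>x \<in> ball 0 1\<close> \<open>y \<in> ball 0 1\<close> by (auto dest: inj_onD)
    qed
    show "f (of_real t * u) \<notin> F ` ball 0 1"
    proof
      assume "f (of_real t * u) \<in> F ` ball 0 1"
      then obtain z where z: "z \<in> ball 0 1" "f (of_real t * u) = f (\<phi> z * u)" by (auto simp: F_def)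
      moreover have "of_real t * u \<in> ball 0 1" using t u by (simp add: norm_mult)
      ultimately have "of_real t * u = \<phi> z * u" using im inj by (meson inj_onD)
      thus False using \<phi>(5) z \<open>u \<noteq> 0\<close> by auto
    qed
  qed
  moreover have "deriv F 0 = deriv f 0 * (of_real (4 * t / (1 + t)\<^sup>2) * u)"
  proof (rule DERIV_imp_deriv)
    have "(f has_field_derivative deriv f 0) (at (\<phi> 0 * u))"
      using holomorphic_derivI[OF f open_ball, of 0] by (simp add: \<phi>(4))
    from DERIV_chain2[OF this DERIV_cmult_right[OF d\<phi>, of u]]
    show "(F has_field_derivative deriv f 0 * (of_real (4 * t / (1 + t)\<^sup>2) * u)) (at 0)"
      by (simp add: F_def)
  qed
  moreover have "norm (complex_of_real (4 * t / (1 + t)\<^sup>2)) = 4 * t / (1 + t)\<^sup>2"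
    unfolding norm_of_real using t by simp
  ultimately have "norm (deriv f 0) * (4 * t / (1 + t)\<^sup>2) \<le> 4 * norm (f (of_real t * u) - f 0)"
    using \<phi>(4) u by (simp only: norm_mult F_def mult_zero_left mult_1_right)
  thus ?thesis using t by (simp add: field_simps)
qed

section \<open>Bieberbach's inequality\<close>

lemma has_real_derivative_norm:
  fixes f :: "real \<Rightarrow> 'a::real_inner"
  assumes "(f has_vector_derivative D) (at t within S)" "f t \<noteq> 0"
  shows "((\<lambda>t. norm (f t)) has_real_derivative inner D (sgn (f t))) (at t within S)"
proof -
  have "((\<lambda>t. norm (f t)) has_derivative (\<lambda>y. inner (y *\<^sub>R D) (sgn (f t)))) (at t within S)"
    using has_derivative_compose[OF assms(1)[unfolded has_vector_derivative_def] has_derivative_norm[OF assms(2)]] .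
  thus ?thesis by (simp add: has_field_derivative_def mult_commute_abs)
qed

text \<open>With \<open>q\<close> the difference quotient of \<open>f\<close> at 0, the growth bound
  says that \<open>norm (q (t * u)) * (1 + t)\<^sup>2\<close> is never below its value at
  \<open>t = 0\<close> for \<open>0 < t < 1\<close>. So its derivative at 0 is nonnegative for every
  direction \<open>u\<close>, and the worst direction gives the claim.\<close>

lemma bieberbach_second_coefficient:
  assumes f: "f holomorphic_on ball 0 1" and inj: "inj_on f (ball 0 1)"
  shows "norm (deriv (deriv f) 0) \<le> 4 * norm (deriv f 0)"
proof -
  have f'0: "deriv f 0 \<noteq> 0"
    by (rule holomorphic_injective_imp_regular[OF f _ inj]) auto
  define q where "q = (\<lambda>z. if z = 0 then deriv f 0 else (f z - f 0) / z)"
  have hq: "q holomorphic_on ball 0 1"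
    using pole_lemma_open[OF f, of 0] by (simp add: q_def cong: if_cong)
  have fq: "f z = f 0 + z * q z" for z by (simp add: q_def)
  have q0: "q 0 = deriv f 0" by (simp add: q_def)
  \<comment> \<open>The second Taylor coefficient of \<open>f\<close>.\<close>
  define D where "D = deriv q 0"
  have dq: "(q has_field_derivative deriv q z) (at z)" if "z \<in> ball 0 1" for z
    using hq that by (intro holomorphic_derivI[of q "ball 0 1"]) auto
  have df: "deriv f z = q z + z * deriv q z" if "z \<in> ball 0 1" for z
  proof (rule DERIV_imp_deriv)
    have "((\<lambda>z. f 0 + z * q z) has_field_derivative q z + z * deriv q z) (at z)"
      by (auto intro!: derivative_eq_intros dq[OF that])
    thus "(f has_field_derivative q z + z * deriv q z) (at z)" by (simp only: fq[symmetric])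
  qed
  have ddf: "deriv (deriv f) 0 = 2 * D"
  proof (rule DERIV_imp_deriv)
    have "(deriv q has_field_derivative deriv (deriv q) 0) (at 0)"
      using hq by (intro holomorphic_derivI[of _ "ball 0 1"] holomorphic_deriv) auto
    hence "((\<lambda>z. q z + z * deriv q z) has_field_derivative 2 * D) (at 0)"
      unfolding D_def by (auto intro!: derivative_eq_intros dq)
    thus "(deriv f has_field_derivative 2 * D) (at 0)"
      by (rule has_field_derivative_transform_within_open[of _ _ _ "ball 0 1"]) (auto simp: df)
  qed
  have lower: "0 \<le> inner (D * u) (sgn (q 0)) + 2 * norm (q 0)" if u: "norm u = 1" for u
  proof (rule ccontr)
    assume neg: "\<not> ?thesis"
    define \<psi> where "\<psi> = (\<lambda>t. norm (q (of_real t * u)) * (1 + t)\<^sup>2)"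
    have "((\<lambda>z. q (z * u)) has_field_derivative D * u) (at (of_real 0))"
      using DERIV_chain2[of q D "\<lambda>z. z * u" 0 u UNIV] dq[of 0]
        DERIV_cmult_right[OF DERIV_ident, of u 0 UNIV]
      by (simp add: D_def)
    hence "((\<lambda>t. q (of_real t * u)) has_vector_derivative D * u) (at 0)"
      by (rule has_vector_derivative_real_field)
    hence "((\<lambda>t. norm (q (of_real t * u))) has_real_derivative inner (D * u) (sgn (q (of_real 0 * u)))) (at 0)"
      using f'0 q0 by (intro has_real_derivative_norm) auto
    hence "(\<psi> has_real_derivative inner (D * u) (sgn (q 0)) + 2 * norm (q 0)) (at 0)"
      unfolding \<psi>_def by (auto intro!: derivative_eq_intros)
    from DERIV_neg_dec_right[OF this] neg
    obtain d where d: "0 < d" "\<And>h. 0 < h \<Longrightarrow> h < d \<Longrightarrow> \<psi> h < \<psi> 0" by auto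
    define t where "t = min (d / 2) (1 / 2)"
    have t: "0 < t" "t < 1" "t < d" using \<open>0 < d\<close> by (auto simp: t_def)
    have "norm (q 0) * t \<le> norm (f (of_real t * u) - f 0) * (1 + t)\<^sup>2"
      using growth_lower_bound[OF f inj t(1,2) u] by (simp add: q0)
    also have "norm (f (of_real t * u) - f 0) = t * norm (q (of_real t * u))"
      using fq[of "of_real t * u"] t u by (simp add: norm_mult)
    finally have "norm (q 0) \<le> \<psi> t" using t by (simp add: \<psi>_def)
    with d(2)[OF t(1,3)] show False by (simp add: \<psi>_def)
  qed
  have "norm D \<le> 2 * norm (q 0)"
  proof (cases "D = 0")
    case False
    \<comment> \<open>The worst direction: it turns \<open>D * u\<close> opposite to
      \<open>q 0\<close>.\<close>
    define u where "u = - (cnj D / norm D * sgn (q 0))"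
    have s1: "norm (sgn (q 0)) = 1" using f'0 q0 by (simp add: norm_sgn)
    have "norm u = 1" using False s1 by (simp add: u_def norm_mult norm_divide)
    moreover have "D * u = (- norm D) *\<^sub>R sgn (q 0)"
      using False complex_norm_square[of D]
      by (simp add: u_def scaleR_conv_of_real field_simps power2_eq_square)
    hence "inner (D * u) (sgn (q 0)) = - norm D"
      using s1 by (simp add: power2_norm_eq_inner[symmetric])
    ultimately show ?thesis using lower[of u] by simp
  qed simp
  thus ?thesis by (simp add: ddf q0 norm_mult)
qed

section \<open>Moving the base point by disk automorphisms\<close>

text \<open>Precomposing with the disk automorphism that carries 0 to \<open>x\<close> keeps the
  image and transfers statements at 0 to \<open>x\<close>. The term with \<open>cnj x\<close> comes
  from the second derivative of the automorphism.\<close>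

lemma koebe_transform:
  assumes h: "h holomorphic_on ball 0 1" and inj: "inj_on h (ball 0 1)" and x: "norm x < 1"
  obtains f where "f holomorphic_on ball 0 1" "inj_on f (ball 0 1)" "f ` ball 0 1 = h ` ball 0 1"
    "f 0 = h x" "deriv f 0 = deriv h x * of_real (1 - (norm x)\<^sup>2)"
    "deriv (deriv f) 0 = of_real (1 - (norm x)\<^sup>2) *
       (of_real (1 - (norm x)\<^sup>2) * deriv (deriv h) x - 2 * cnj x * deriv h x)"
proof -
  define c where "c = complex_of_real (1 - (norm x)\<^sup>2)"
  have c: "c = 1 - x * cnj x"
    unfolding c_def of_real_diff complex_norm_square by simp
  define M where "M = Moebius_function 0 (-x)"
  have M: "M z = (z + x) / (1 + cnj x * z)" for z
    by (simp add: M_def Moebius_function_simple)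
  have Mb: "M z \<in> ball 0 1" if "z \<in> ball 0 1" for z
    using Moebius_function_norm_lt_1[of "-x" z 0] x that by (simp add: M_def)
  have inv: "Moebius_function 0 x (M z) = z" "M (Moebius_function 0 x z) = z" if "z \<in> ball 0 1" for z
    using Moebius_function_compose[of x "-x" z] Moebius_function_compose[of "-x" x z] x that
    by (simp_all add: M_def)
  have nz: "1 + cnj x * z \<noteq> 0" if "z \<in> ball 0 1" for z
  proof -
    have "norm (cnj x * z) < 1" using norm_mult_less[of "cnj x" 1 z 1] x that by simp
    thus ?thesis by (metis add_eq_0_iff norm_minus_cancel norm_one less_irrefl)
  qed
  have dM: "(M has_field_derivative c / (1 + cnj x * z)\<^sup>2) (at z)" if "z \<in> ball 0 1" for z
    unfolding M using nz[OF that]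
    by (auto intro!: derivative_eq_intros simp: c field_simps power2_eq_square)
  have imM: "M ` ball 0 1 = ball 0 1"
  proof
    show "ball 0 1 \<subseteq> M ` ball 0 1"
    proof
      fix z :: complex assume z: "z \<in> ball 0 1"
      hence "Moebius_function 0 x z \<in> ball 0 1"
        using Moebius_function_norm_lt_1[of x z 0] x by simp
      with inv(2)[OF z] show "z \<in> M ` ball 0 1" by (metis imageI)
    qed
  qed (use Mb in auto)
  have M0: "M 0 = x" by (simp add: M)
  define f where "f = (\<lambda>z. h (M z))"
  have df: "(f has_field_derivative deriv h (M z) * (c / (1 + cnj x * z)\<^sup>2)) (at z)"
    if "z \<in> ball 0 1" for z
    unfolding f_def
    by (rule DERIV_chain2[OF holomorphic_derivI[OF h open_ball Mb[OF that]] dM[OF that]])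
  show ?thesis
  proof
    show "f holomorphic_on ball 0 1"
      unfolding holomorphic_on_open[OF open_ball] using df by blast
    show "inj_on f (ball 0 1)"
    proof (rule inj_onI)
      fix y z assume yz: "y \<in> ball 0 1" "z \<in> ball 0 1" "f y = f z"
      hence "M y = M z" using Mb inj by (auto simp: f_def dest: inj_onD)
      thus "y = z" using inv(1) yz by metis
    qed
    show "f ` ball 0 1 = h ` ball 0 1"
      using imM by (simp add: f_def image_image[symmetric])
    show "f 0 = h x" by (simp add: f_def M0)
    show "deriv f 0 = deriv h x * of_real (1 - (norm x)\<^sup>2)"
      using DERIV_imp_deriv[OF df[of 0]] by (simp add: M0 c_def)
    have "deriv h holomorphic_on ball 0 1" by (intro holomorphic_deriv h) simp
    from holomorphic_derivI[OF this open_ball, of x]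
    have "(deriv h has_field_derivative deriv (deriv h) x) (at (M 0))"
      using x by (simp add: M0)
    from DERIV_chain2[where g = M and x = 0, OF this dM[of 0]]
    have 1: "((\<lambda>z. deriv h (M z)) has_field_derivative deriv (deriv h) x * c) (at 0)" by simp
    have "((\<lambda>z. deriv h (M z) * (c / (1 + cnj x * z)\<^sup>2)) has_field_derivative
        c * (c * deriv (deriv h) x - 2 * cnj x * deriv h x)) (at 0)"
      by (rule derivative_eq_intros 1 refl | simp)+ (simp add: M0 algebra_simps)
    hence "(deriv f has_field_derivative c * (c * deriv (deriv h) x - 2 * cnj x * deriv h x)) (at 0)"
      by (rule has_field_derivative_transform_within_open[of _ _ _ "ball 0 1"])
         (use DERIV_imp_deriv[OF df] in auto)
    thus "deriv (deriv f) 0 = of_real (1 - (norm x)\<^sup>2) *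
       (of_real (1 - (norm x)\<^sup>2) * deriv (deriv h) x - 2 * cnj x * deriv h x)"
      by (simp add: DERIV_imp_deriv c_def)
  qed
qed



section \<open>Conformal radius and the covering disk\<close>

definition conf_radius :: "(complex \<Rightarrow> complex) \<Rightarrow> complex \<Rightarrow> real" where
  "conf_radius h x = norm (deriv h x) * (1 - (norm x)\<^sup>2)"

text \<open>Koebe's theorem for the transform at \<open>x\<close>, whose derivative at 0 has modulus
  \<open>conf_radius h x\<close>.\<close>

lemma ball_subset_univalent_image:
  assumes h: "h holomorphic_on ball 0 1" and inj: "inj_on h (ball 0 1)" and x: "norm x < 1"
  shows "ball (h x) (conf_radius h x / 4) \<subseteq> h ` ball 0 1"
proof
  fix w assume "w \<in> ball (h x) (conf_radius h x / 4)"
  hence w: "4 * norm (w - h x) < conf_radius h x" by (simp add: dist_norm norm_minus_commute)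
  obtain f where f: "f holomorphic_on ball 0 1" "inj_on f (ball 0 1)" "f ` ball 0 1 = h ` ball 0 1"
    "f 0 = h x" "deriv f 0 = deriv h x * of_real (1 - (norm x)\<^sup>2)"
    by (rule koebe_transform[OF assms])
  have "(norm x)\<^sup>2 < 1" using x by (simp add: power_less_one_iff)
  hence "norm (deriv f 0) = conf_radius h x"
    unfolding f(5) norm_mult norm_of_real conf_radius_def by simp
  hence "\<not> norm (deriv f 0) \<le> 4 * norm (w - f 0)"
    using w by (simp add: f(4))
  thus "w \<in> h ` ball 0 1"
    using koebe_quarter[OF f(1,2), of w] unfolding f(3) by (rule contrapos_np)
qed

text \<open>Bieberbach's inequality for the transform at \<open>x\<close>, with the factor
  \<open>1 - (norm x)\<^sup>2\<close> cancelled. The left side is the length of the gradient of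
  \<open>conf_radius h\<close> at \<open>x\<close>.\<close>

lemma univalent_second_derivative_bound:
  assumes h: "h holomorphic_on ball 0 1" and inj: "inj_on h (ball 0 1)" and x: "norm x < 1"
  shows "norm (of_real (1 - (norm x)\<^sup>2) * deriv (deriv h) x - 2 * cnj x * deriv h x)
    \<le> 4 * norm (deriv h x)"
proof -
  obtain f where f: "f holomorphic_on ball 0 1" "inj_on f (ball 0 1)"
    and d: "deriv f 0 = deriv h x * of_real (1 - (norm x)\<^sup>2)"
    "deriv (deriv f) 0 = of_real (1 - (norm x)\<^sup>2) *
       (of_real (1 - (norm x)\<^sup>2) * deriv (deriv h) x - 2 * cnj x * deriv h x)"
    by (rule koebe_transform[OF assms])
  have "(norm x)\<^sup>2 < 1" using x by (simp add: power_less_one_iff)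
  hence pos: "norm (complex_of_real (1 - (norm x)\<^sup>2)) = 1 - (norm x)\<^sup>2" "0 < 1 - (norm x)\<^sup>2"
    unfolding norm_of_real by auto
  have "norm (deriv (deriv f) 0) \<le> 4 * norm (deriv f 0)"
    by (rule bieberbach_second_coefficient[OF f])
  thus ?thesis using pos(2) unfolding d norm_mult pos(1) by (simp add: mult.left_commute)
qed

text \<open>The velocity of \<open>X\<close> is the one for which \<open>h (X t)\<close> moves with
  velocity \<open>v\<close>. The gradient bound \<open>4 * norm (deriv h x)\<close> then cancels
  against the denominator, leaving a constant independent of \<open>h\<close>.\<close>

lemma conf_radius_has_derivative:
  assumes h: "h holomorphic_on ball 0 1" and inj: "inj_on h (ball 0 1)"
    and X: "(X has_vector_derivative v / deriv h (X t)) (at t within S)" and Xt: "norm (X t) < 1"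
  obtains D where "((\<lambda>t. conf_radius h (X t)) has_real_derivative D) (at t within S)"
    "\<bar>D\<bar> \<le> 4 * norm v"
proof -
  define x where "x = X t"
  define a where "a = deriv h x"
  define b where "b = deriv (deriv h) x"
  define p where "p = v / a"
  define r where "r = 1 - (norm x)\<^sup>2"
  have a0: "a \<noteq> 0"
    unfolding a_def by (rule holomorphic_injective_imp_regular[OF h _ inj]) (use Xt in \<open>auto simp: x_def\<close>)
  have "deriv h holomorphic_on ball 0 1" by (intro holomorphic_deriv h) simp
  from holomorphic_derivI[OF this open_ball, of x]
  have "(deriv h has_field_derivative b) (at (X t))"
    using Xt by (simp add: x_def b_def)
  hence "((\<lambda>t. deriv h (X t)) has_vector_derivative p * b) (at t within S)"
    using field_vector_diff_chain_within[OF X, of "deriv h" b] 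
    by (simp add: o_def p_def a_def x_def has_field_derivative_at_within)
  hence 1: "((\<lambda>t. norm (deriv h (X t))) has_real_derivative inner (p * b) (sgn a)) (at t within S)"
    using has_real_derivative_norm[of "\<lambda>t. deriv h (X t)"] a0 by (simp add: a_def x_def)
  have "((\<lambda>t. inner (X t) (X t)) has_derivative (\<lambda>y. inner (X t) (y *\<^sub>R p) + inner (y *\<^sub>R p) (X t))) (at t within S)"
    using X by (intro has_derivative_inner) (simp_all add: has_vector_derivative_def p_def a_def x_def)
  hence 2: "((\<lambda>t. (norm (X t))\<^sup>2) has_real_derivative 2 * inner p x) (at t within S)"
    by (simp add: has_field_derivative_def power2_norm_eq_inner x_def inner_commute mult_commute_abs algebra_simps)
  define D where "D = inner (p * b) (sgn a) * r - norm a * (2 * inner p x)"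
  have "((\<lambda>t. conf_radius h (X t)) has_real_derivative D) (at t within S)"
    unfolding conf_radius_def D_def r_def a_def x_def
    by (rule derivative_eq_intros 1[unfolded a_def x_def] 2[unfolded x_def] refl)+ (simp add: algebra_simps)
  moreover have "\<bar>D\<bar> \<le> 4 * norm v"
  proof -
    have inner_Re: "inner y z = Re (y * cnj z)" for y z :: complex
      by (simp add: inner_complex_def)
    \<comment> \<open>Extracting the unimodular factor \<open>cnj (sgn a)\<close> exhibits
      \<open>D\<close> as a real part involving exactly the expression bounded by Bieberbach's
      inequality.\<close>
    have sg: "cnj (sgn a) * a = of_real (norm a)"
      using a0 complex_norm_square[of a]
      by (simp add: sgn_eq field_simps power2_eq_square)
    have "D = Re (p * cnj (sgn a) * (of_real r * b - 2 * cnj x * a))"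
    proof -
      have "p * cnj (sgn a) * (of_real r * b - 2 * cnj x * a)
        = of_real r * (p * b * cnj (sgn a)) - of_real (norm a) * (2 * (p * cnj x))"
        unfolding sg[symmetric] by (simp add: algebra_simps)
      moreover have "D = Re (of_real r * (p * b * cnj (sgn a)) - of_real (norm a) * (2 * (p * cnj x)))"
        by (simp add: D_def inner_Re mult.commute[of _ r])
      ultimately show ?thesis by simp
    qed
    hence "\<bar>D\<bar> \<le> norm (p * cnj (sgn a) * (of_real r * b - 2 * cnj x * a))"
      by (simp only: abs_Re_le_cmod)
    also have "\<dots> = norm p * norm (of_real r * b - 2 * cnj x * a)"
      using a0 by (simp add: norm_mult norm_sgn)
    also have "\<dots> \<le> norm p * (4 * norm a)"
      using univalent_second_derivative_bound[OF h inj, of x] Xt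
      by (intro mult_left_mono) (simp_all add: r_def a_def b_def x_def)
    also have "\<dots> = 4 * norm v" using a0 by (simp add: p_def norm_divide)
    finally show ?thesis .
  qed
  ultimately show ?thesis by (rule that)
qed

text \<open>The inverse of \<open>h\<close> pulls the segment back to a path \<open>X\<close> in the
  disk with velocity \<open>v / deriv h (X t)\<close>; the mean value inequality applies to
  \<open>conf_radius h\<close> along it.\<close>

lemma conf_radius_lipschitz_on_segment:
  assumes h: "h holomorphic_on ball 0 1" and inj: "inj_on h (ball 0 1)"
    and x: "norm x < 1" and y: "norm y < 1" and seg: "closed_segment (h x) (h y) \<subseteq> h ` ball 0 1"
  shows "conf_radius h x - conf_radius h y \<le> 4 * norm (h y - h x)"
proof -
  obtain g where hg: "g holomorphic_on h ` ball 0 1"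
    and dg: "\<And>z. z \<in> ball 0 1 \<Longrightarrow> deriv h z * deriv g (h z) = 1"
    and gh: "\<And>z. z \<in> ball 0 1 \<Longrightarrow> g (h z) = z"
    using holomorphic_has_inverse[OF h _ inj] by auto
  have op: "open (h ` ball 0 1)" using h inj by (intro open_mapping_thm3) auto
  define v where "v = h y - h x"
  define X where "X = (\<lambda>t::real. g (h x + t *\<^sub>R v))"
  have "\<exists>D. ((\<lambda>t. conf_radius h (X t)) has_real_derivative D) (at t within {0..1}) \<and> \<bar>D\<bar> \<le> 4 * norm v"
    if t: "t \<in> {0..1}" for t
  proof -
    have "h x + t *\<^sub>R v \<in> closed_segment (h x) (h y)"
      unfolding closed_segment_def using t by (auto simp: v_def algebra_simps intro!: exI[of _ t])
    then obtain z where z: "z \<in> ball 0 1" "h x + t *\<^sub>R v = h z" using seg by auto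
    hence Xt: "X t = z" by (simp add: X_def gh)
    have "(g has_field_derivative deriv g (h z)) (at (h z))"
      using hg op z by (intro holomorphic_derivI) auto
    also have "deriv g (h z) = 1 / deriv h z"
      using dg[OF z(1)] by (metis mult_eq_0_iff nonzero_mult_div_cancel_left one_neq_zero)
    finally have "(g has_field_derivative 1 / deriv h z) (at (h x + t *\<^sub>R v))"
      by (simp add: z)
    moreover have "((\<lambda>t. h x + t *\<^sub>R v) has_vector_derivative v) (at t within {0..1})"
      by (auto intro!: derivative_eq_intros)
    ultimately have "(X has_vector_derivative v / deriv h (X t)) (at t within {0..1})"
      using field_vector_diff_chain_within[of "\<lambda>t. h x + t *\<^sub>R v" v t "{0..1}" g "1 / deriv h z"]
      by (simp add: X_def o_def has_field_derivative_at_within Xt[unfolded X_def])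
    thus ?thesis
      using conf_radius_has_derivative[OF h inj] Xt z by (metis mem_ball_0)
  qed
  then obtain D where "\<And>t. t \<in> {0..1} \<Longrightarrow> ((\<lambda>t. conf_radius h (X t)) has_real_derivative D t) (at t within {0..1})"
    "\<And>t. t \<in> {0..1} \<Longrightarrow> norm (D t) \<le> 4 * norm v" by (metis real_norm_def)
  from field_differentiable_bound[OF convex_real_interval(5) this, of 0 1]
  have "\<bar>conf_radius h (X 0) - conf_radius h (X 1)\<bar> \<le> 4 * norm v" by simp
  moreover have "X 0 = x" "X 1 = y" using x y by (simp_all add: X_def v_def gh)
  ultimately show ?thesis by (simp add: v_def)
qed

theorem theorem1:
  fixes h :: "complex \<Rightarrow> complex" and x0 :: complex and \<alpha> :: real
  assumes "h holomorphic_on ball 0 1"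
    and "inj_on h (ball 0 1)"
    and "0 < \<alpha>" and "\<alpha> < 1"
    and "x0 \<in> ball 0 1"
  shows "ball (h x0) ((1 - \<alpha>) / 4 * norm (deriv h x0) * (1 - (norm x0)\<^sup>2)) \<subseteq> h ` Omega h x0 \<alpha>"
proof
  define R where "R = conf_radius h x0"
  have x0: "norm x0 < 1" using assms(5) by simp
  hence "(norm x0)\<^sup>2 < 1" by (simp add: power_less_one_iff)
  hence "0 \<le> R" by (simp add: R_def conf_radius_def)
  fix w assume "w \<in> ball (h x0) ((1 - \<alpha>) / 4 * norm (deriv h x0) * (1 - (norm x0)\<^sup>2))"
  hence w: "dist (h x0) w < (1 - \<alpha>) * R / 4" by (simp add: R_def conf_radius_def mult.assoc)
  have "\<alpha> * R \<ge> 0" using assms(3) \<open>0 \<le> R\<close> by simp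
  hence wR: "w \<in> ball (h x0) (R / 4)" using w by (simp add: algebra_simps)
  have image: "ball (h x0) (R / 4) \<subseteq> h ` ball 0 1"
    unfolding R_def by (rule ball_subset_univalent_image[OF assms(1,2) x0])
  then obtain x where x: "x \<in> ball 0 1" "w = h x" using wR by blast
  \<comment> \<open>The ball contains \<open>w\<close>, so its radius is positive and it contains
    its centre; convexity then puts the whole segment into the image.\<close>
  have "h x0 \<in> ball (h x0) (R / 4)" using wR by (metis centre_in_ball empty_iff ball_eq_empty not_le)
  hence "closed_segment (h x0) w \<subseteq> ball (h x0) (R / 4)"
    using wR by (intro closed_segment_subset) auto
  with image have "closed_segment (h x0) (h x) \<subseteq> h ` ball 0 1"
    unfolding x(2) by (rule subset_trans[rotated])
  hence "R - conf_radius h x \<le> 4 * norm (h x - h x0)"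
    unfolding R_def using x x0
    by (intro conf_radius_lipschitz_on_segment[OF assms(1,2)]) auto
  \<comment> \<open>Here \<open>4 * norm (h x - h x0) < (1 - \<alpha>) * R\<close>, so less than
    that is lost from \<open>R\<close>, and more than \<open>\<alpha> * R\<close> remains.\<close>
  with w have "\<alpha> * R < conf_radius h x"
    by (simp add: x dist_norm norm_minus_commute algebra_simps)
  hence "x \<in> Omega h x0 \<alpha>"
    using x by (simp add: Omega_def R_def conf_radius_def mult.assoc)
  thus "w \<in> h ` Omega h x0 \<alpha>" using x by blast
qed
end
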